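(* The class of matroids with an adjoint is minor-closed; that is, if a matroid $M$ has an adjoint and $N$ is a minor of $M$, then $N$ has an adjoint.
   Context: Matroid terminology follows Oxley's book; in particular matroids are finite. $\mathcal{F}(M)$ denotes the collection of flats of a matroid $M$. A hyperplane of $M$ is a flat of rank $r(M)-1$; a point is a flat of rank $1$ (in a simple matroid, the points are exactly the singletons of elements of the ground set, and are identified with the elements). Definition. Let $M$ be a matroid, and let $M'$ be a simple matroid with the same rank as $M$. Then $M'$ is an adjoint of $M$ if there is a map $\phi:\mathcal{F}(M)\rightarrow\mathcal{F}(M')$ such that (i) $\phi$ is injective; (ii) if $F_1,F_2\in\mathcal{F}(M)$ and $F_1\subseteq F_2$, then $\phi(F_2)\subseteq\phi(F_1)$; and (iii) $\phi$ restricts to a bijection from the set of hyperplanes of $M$ onto the set of points of $M'$. Such a map $\phi$ is called an adjoint map from $M$ to $M'$. A matroid has an adjoint if some such $M'$ exists. *)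

theory Defs
  imports Main
begin

datatype 'a matroid_data =
  Matroid (ground: "'a set") (indep: "'a set set")

definition matroid :: "'a matroid_data \<Rightarrow> bool" where
  "matroid M \<longleftrightarrow>
     finite (ground M) \<and>
     (\<forall>I\<in>indep M. I \<subseteq> ground M) \<and>
     {} \<in> indep M \<and>
     (\<forall>I\<in>indep M. \<forall>J. J \<subseteq> I \<longrightarrow> J \<in> indep M) \<and>
     (\<forall>I\<in>indep M. \<forall>J\<in>indep M. card I < card J \<longrightarrow>
        (\<exists>e\<in>J - I. insert e I \<in> indep M))"

definition rank :: "'a matroid_data \<Rightarrow> 'a set \<Rightarrow> nat" where
  "rank M X = Max (card ` {I \<in> indep M. I \<subseteq> X})"

definition closure :: "'a matroid_data \<Rightarrow> 'a set \<Rightarrow> 'a set" where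
  "closure M X = {e \<in> ground M. rank M (insert e X) = rank M X}"

definition flats :: "'a matroid_data \<Rightarrow> 'a set set" where
  "flats M = {F. F \<subseteq> ground M \<and> closure M F = F}"

text \<open>The rank condition is written additively because subtraction on \<^typ>\<open>nat\<close>
  truncates: a matroid of rank 0 has no hyperplanes.\<close>

definition hyperplanes :: "'a matroid_data \<Rightarrow> 'a set set" where
  "hyperplanes M = {F \<in> flats M. rank M F + 1 = rank M (ground M)}"

definition points :: "'a matroid_data \<Rightarrow> 'a set set" where
  "points M = {F \<in> flats M. rank M F = 1}"

definition circuits :: "'a matroid_data \<Rightarrow> 'a set set" where
  "circuits M = {C. C \<subseteq> ground M \<and> C \<notin> indep M \<and> (\<forall>J. J \<subset> C \<longrightarrow> J \<in> indep M)}"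

definition simple_matroid :: "'a matroid_data \<Rightarrow> bool" where
  "simple_matroid M \<longleftrightarrow> matroid M \<and>
     (\<forall>e. {e} \<notin> circuits M) \<and> (\<forall>e f. e \<noteq> f \<longrightarrow> {e, f} \<notin> circuits M)"

definition bases :: "'a matroid_data \<Rightarrow> 'a set set" where
  "bases M = {B \<in> indep M. \<forall>I\<in>indep M. B \<subseteq> I \<longrightarrow> I = B}"

text \<open>The bases of the dual are the complements of the bases.\<close>

definition dual :: "'a matroid_data \<Rightarrow> 'a matroid_data" where
  "dual M = Matroid (ground M) {I. \<exists>B\<in>bases M. I \<subseteq> ground M - B}"

definition delete :: "'a matroid_data \<Rightarrow> 'a set \<Rightarrow> 'a matroid_data" where
  "delete M D = Matroid (ground M - D) {I \<in> indep M. I \<subseteq> ground M - D}"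

definition contract :: "'a matroid_data \<Rightarrow> 'a set \<Rightarrow> 'a matroid_data" where
  "contract M C = dual (delete (dual M) C)"

definition minor :: "'a matroid_data \<Rightarrow> 'a matroid_data \<Rightarrow> bool" where
  "minor N M \<longleftrightarrow>
     (\<exists>C D. C \<subseteq> ground M \<and> D \<subseteq> ground M \<and> C \<inter> D = {} \<and> N = delete (contract M C) D)"

definition adjoint_map ::
  "'a matroid_data \<Rightarrow> 'b matroid_data \<Rightarrow> ('a set \<Rightarrow> 'b set) \<Rightarrow> bool" where
  "adjoint_map M M' \<phi> \<longleftrightarrow>
     \<phi> ` flats M \<subseteq> flats M' \<and>
     inj_on \<phi> (flats M) \<and>
     (\<forall>F\<^sub>1\<in>flats M. \<forall>F\<^sub>2\<in>flats M. F\<^sub>1 \<subseteq> F\<^sub>2 \<longrightarrow> \<phi> F\<^sub>2 \<subseteq> \<phi> F\<^sub>1) \<and>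
     bij_betw \<phi> (hyperplanes M) (points M')"

definition adjoint :: "'a matroid_data \<Rightarrow> 'b matroid_data \<Rightarrow> bool" where
  "adjoint M M' \<longleftrightarrow>
     matroid M \<and> simple_matroid M' \<and>
     rank M' (ground M') = rank M (ground M) \<and>
     (\<exists>\<phi>. adjoint_map M M' \<phi>)"

text \<open>HOL cannot quantify over the type of the elements of the adjoint. Since matroids
  are finite, it is no restriction to take these elements to be natural numbers: lemma
  \<open>has_adjointI\<close> below shows that an adjoint over any type yields one over
  \<^typ>\<open>nat\<close>.\<close>

definition has_adjoint :: "'a matroid_data \<Rightarrow> bool" where
  "has_adjoint M \<longleftrightarrow> (\<exists>M' :: nat matroid_data. adjoint M M')"

definition relabel :: "('a \<Rightarrow> 'b) \<Rightarrow> 'a matroid_data \<Rightarrow> 'b matroid_data" where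
  "relabel f M = Matroid (f ` ground M) ((`) f ` indep M)"

context
  fixes f :: "'a \<Rightarrow> 'b" and M :: "'a matroid_data"
  assumes M: "matroid M" and f: "inj_on f (ground M)"
begin

lemma indep_relabel:
  assumes "X \<subseteq> ground M"
  shows "f ` X \<in> indep (relabel f M) \<longleftrightarrow> X \<in> indep M"
proof
  assume "f ` X \<in> indep (relabel f M)"
  then obtain I where I: "I \<in> indep M" "f ` X = f ` I"
    by (auto simp: relabel_def)
  then have "I \<subseteq> ground M" using M by (auto simp: matroid_def)
  then have "X = I" using I assms f by (simp add: inj_on_image_eq_iff)
  then show "X \<in> indep M" using I by simp
qed (auto simp: relabel_def)

lemma subset_relabel:
  "Y \<subseteq> ground (relabel f M) \<longleftrightarrow> (\<exists>X\<subseteq>ground M. Y = f ` X)"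
  by (auto simp: relabel_def subset_image_iff)

lemma indep_relabelE:
  assumes "Y \<in> indep (relabel f M)"
  obtains X where "X \<in> indep M" "X \<subseteq> ground M" "Y = f ` X"
  using assms M by (auto simp: relabel_def matroid_def)

lemma card_relabel: "X \<subseteq> ground M \<Longrightarrow> card (f ` X) = card X"
  using f by (meson card_image inj_on_subset)

lemma image_subset_relabel:
  "X \<subseteq> ground M \<Longrightarrow> Y \<subseteq> ground M \<Longrightarrow> f ` X \<subseteq> f ` Y \<longleftrightarrow> X \<subseteq> Y"
  by (metis f image_Un inj_on_image_eq_iff le_sup_iff subset_Un_eq)

lemma image_eq_relabel:
  "X \<subseteq> ground M \<Longrightarrow> Y \<subseteq> ground M \<Longrightarrow> f ` X = f ` Y \<longleftrightarrow> X = Y"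
  using f by (rule inj_on_image_eq_iff)

lemma matroid_relabel: "matroid (relabel f M)"
  unfolding matroid_def
proof (intro conjI ballI allI impI)
  show "finite (ground (relabel f M))" using M by (simp add: relabel_def matroid_def)
  show "I \<subseteq> ground (relabel f M)" if "I \<in> indep (relabel f M)" for I
    using that M by (auto simp: relabel_def matroid_def)
  show "{} \<in> indep (relabel f M)" using M by (auto simp: relabel_def matroid_def)
  show "J \<in> indep (relabel f M)" if I: "I \<in> indep (relabel f M)" and J: "J \<subseteq> I" for I J
  proof -
    obtain X where X: "X \<in> indep M" "I = f ` X" using I by (rule indep_relabelE)
    with J obtain Y where "Y \<subseteq> X" "J = f ` Y" by (auto simp: subset_image_iff)
    then show ?thesis using X M by (auto simp: relabel_def matroid_def)
  qed
  show "\<exists>e\<in>J - I. insert e I \<in> indep (relabel f M)"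
    if I: "I \<in> indep (relabel f M)" and J: "J \<in> indep (relabel f M)"
      and less: "card I < card J" for I J
  proof -
    obtain X where X: "X \<in> indep M" "X \<subseteq> ground M" "I = f ` X"
      using I by (rule indep_relabelE)
    obtain Y where Y: "Y \<in> indep M" "Y \<subseteq> ground M" "J = f ` Y"
      using J by (rule indep_relabelE)
    have "card X < card Y" using less X Y by (simp add: card_relabel)
    moreover have "\<forall>I\<in>indep M. \<forall>J\<in>indep M. card I < card J \<longrightarrow>
        (\<exists>e\<in>J - I. insert e I \<in> indep M)"
      using M by (simp add: matroid_def)
    ultimately obtain e where e: "e \<in> Y - X" "insert e X \<in> indep M"
      using X(1) Y(1) by meson
    have "f e \<in> J - I" using e X Y f by (auto dest: inj_onD)
    moreover have "insert (f e) I \<in> indep (relabel f M)"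
      using e X by (auto simp: relabel_def image_iff intro!: bexI[of _ "insert e X"])
    ultimately show ?thesis by blast
  qed
qed

lemma rank_relabel:
  assumes "X \<subseteq> ground M"
  shows "rank (relabel f M) (f ` X) = rank M X"
proof -
  have "{I \<in> indep (relabel f M). I \<subseteq> f ` X} = (`) f ` {I \<in> indep M. I \<subseteq> X}"
    using M assms by (auto simp: relabel_def matroid_def image_subset_relabel)
  moreover have "card ` (`) f ` {I \<in> indep M. I \<subseteq> X} = card ` {I \<in> indep M. I \<subseteq> X}"
    unfolding image_image using assms by (intro image_cong) (auto simp: card_relabel)
  ultimately show ?thesis by (simp add: rank_def)
qed

lemma closure_relabel:
  assumes "X \<subseteq> ground M"
  shows "closure (relabel f M) (f ` X) = f ` closure M X"
proof -
  have "rank (relabel f M) (insert (f e) (f ` X)) = rank M (insert e X)"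
    if "e \<in> ground M" for e
    using rank_relabel[of "insert e X"] that assms by simp
  then show ?thesis
    using assms by (auto simp: closure_def rank_relabel) (auto simp: relabel_def)
qed

lemma flats_relabel: "flats (relabel f M) = (`) f ` flats M"
proof -
  have "closure M X \<subseteq> ground M" for X by (auto simp: closure_def)
  then show ?thesis
    by (auto simp: flats_def subset_relabel closure_relabel image_eq_relabel)
qed

lemma points_relabel: "points (relabel f M) = (`) f ` points M"
proof -
  have "F \<subseteq> ground M" if "F \<in> flats M" for F using that by (simp add: flats_def)
  then show ?thesis by (auto simp: points_def flats_relabel rank_relabel)
qed

lemma circuits_relabel:
  assumes "X \<subseteq> ground M" "f ` X \<in> circuits (relabel f M)"
  shows "X \<in> circuits M"
proof -
  have "J \<in> indep M" if "J \<subset> X" for J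
  proof -
    have J: "J \<subseteq> ground M" using that assms by auto
    then have "f ` J \<subset> f ` X" using that assms(1)
      by (simp add: psubset_eq image_subset_relabel image_eq_relabel)
    then have "f ` J \<in> indep (relabel f M)" using assms by (auto simp: circuits_def)
    then show ?thesis using J by (simp add: indep_relabel)
  qed
  then show ?thesis using assms by (auto simp: circuits_def indep_relabel)
qed

lemma simple_relabel:
  assumes "simple_matroid M"
  shows "simple_matroid (relabel f M)"
  unfolding simple_matroid_def
proof (intro conjI allI impI notI)
  show "matroid (relabel f M)" by (rule matroid_relabel)
  show False if "{e} \<in> circuits (relabel f M)" for e
  proof -
    from that have "e \<in> f ` ground M" by (auto simp: circuits_def relabel_def)
    then obtain a where a: "a \<in> ground M" "e = f a" by auto
    then show False
      using that circuits_relabel[of "{a}"] assms by (simp add: simple_matroid_def)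
  qed
  show False if "e \<noteq> g" "{e, g} \<in> circuits (relabel f M)" for e g
  proof -
    from that have "e \<in> f ` ground M" "g \<in> f ` ground M"
      by (auto simp: circuits_def relabel_def)
    then obtain a b where "a \<in> ground M" "e = f a" "b \<in> ground M" "g = f b" by auto
    then show False
      using that circuits_relabel[of "{a, b}"] assms unfolding simple_matroid_def
      by (metis bot_least image_empty image_insert insert_subset)
  qed
qed

end

lemma has_adjointI:
  fixes M :: "'a matroid_data" and M' :: "'b matroid_data"
  assumes "adjoint M M'"
  shows "has_adjoint M"
proof -
  have M': "matroid M'" using assms by (simp add: adjoint_def simple_matroid_def)
  then have "finite (ground M')" by (simp add: matroid_def)
  then obtain f :: "'b \<Rightarrow> nat" where f: "inj_on f (ground M')"
    using finite_imp_inj_to_nat_seg by blast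
  obtain \<phi> where "adjoint_map M M' \<phi>" using assms by (auto simp: adjoint_def)
  then have \<phi>: "\<phi> ` flats M \<subseteq> flats M'" "inj_on \<phi> (flats M)"
    "\<And>F\<^sub>1 F\<^sub>2. F\<^sub>1 \<in> flats M \<Longrightarrow> F\<^sub>2 \<in> flats M \<Longrightarrow> F\<^sub>1 \<subseteq> F\<^sub>2 \<Longrightarrow> \<phi> F\<^sub>2 \<subseteq> \<phi> F\<^sub>1"
    "bij_betw \<phi> (hyperplanes M) (points M')"
    by (simp_all add: adjoint_map_def)
  have inj: "inj_on ((`) f) (flats M')"
    by (rule inj_on_subset[OF inj_on_image_Pow[OF f]]) (auto simp: flats_def)
  have "adjoint_map M (relabel f M') ((`) f \<circ> \<phi>)"
    unfolding adjoint_map_def flats_relabel[OF M' f] points_relabel[OF M' f]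
  proof (intro conjI ballI impI)
    show "((`) f \<circ> \<phi>) ` flats M \<subseteq> (`) f ` flats M'"
      unfolding image_comp[symmetric] using \<phi>(1) by (rule image_mono)
    show "inj_on ((`) f \<circ> \<phi>) (flats M)"
      by (rule comp_inj_on[OF \<phi>(2) inj_on_subset[OF inj \<phi>(1)]])
    show "((`) f \<circ> \<phi>) F\<^sub>2 \<subseteq> ((`) f \<circ> \<phi>) F\<^sub>1"
      if "F\<^sub>1 \<in> flats M" "F\<^sub>2 \<in> flats M" "F\<^sub>1 \<subseteq> F\<^sub>2" for F\<^sub>1 F\<^sub>2
      unfolding comp_apply by (intro image_mono \<phi>(3) that)
    have "bij_betw ((`) f) (points M') ((`) f ` points M')"
      by (rule inj_on_imp_bij_betw, rule inj_on_subset[OF inj]) (auto simp: points_def)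
    then show "bij_betw ((`) f \<circ> \<phi>) (hyperplanes M) ((`) f ` points M')"
      by (rule bij_betw_trans[OF \<phi>(4)])
  qed
  moreover have "rank (relabel f M') (ground (relabel f M')) = rank M' (ground M')"
    using rank_relabel[OF M' f subset_refl] by (simp add: relabel_def)
  moreover have "simple_matroid (relabel f M')"
    using assms simple_relabel[OF M' f] by (simp add: adjoint_def)
  ultimately have "adjoint M (relabel f M')"
    using assms unfolding adjoint_def by metis
  then show ?thesis unfolding has_adjoint_def by blast
qed

end

theory Submission
  imports Defs
begin

text \<open>A minor \<open>N\<close> inherits an adjoint because its flats sit among those of
  \<open>M\<close> with unchanged coranks. Write \<open>N\<close> as \<open>M\<close> contracted by
  \<open>C\<close> and restricted to \<open>S\<close>. The deletion may lower the rank, so a set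
  \<open>B\<close> of size r(M) - r(S \<union> C) is chosen that completes S \<union> C to a
  spanning set. Sending F to the closure of F \<union> C \<union> B is then injective,
  inclusion-preserving and corank-preserving on flats, by \<open>rank_contract\<close> and
  submodularity.

  Let \<theta> be this embedding followed by an adjoint map into \<open>M'\<close>. It is injective,
  reverses inclusions and takes hyperplanes of \<open>N\<close> to points, but \<open>M'\<close> may
  have too large a rank and too many points. In \<open>has_adjoint_of_flat_embedding\<close>,
  \<open>M'\<close> is restricted to the set Q of points \<theta> H with H a hyperplane of
  \<open>N\<close>, and each \<theta> F is intersected with Q. Nothing is lost if P F, the points
  from hyperplanes above F, spans \<theta> F.

  The rank of \<theta> F is at most the corank of F, since a chain of flats strictly increasing up
  to F has strictly decreasing images (\<open>adjoint_map_rank_le\<close>). The rank of P F is at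
  least the corank, by induction: were it smaller, P K and P F would have the same closure \<theta>
  K for every cover K of F, whereas a flat of corank at least two has two distinct covers
  (\<open>exists_distinct_covers\<close>) and \<theta> is injective.\<close>

section \<open>Rank and closure\<close>

lemma matroid_finite: "matroid M \<Longrightarrow> finite (ground M)"
  by (simp add: matroid_def)

lemma indep_subset_ground: "matroid M \<Longrightarrow> I \<in> indep M \<Longrightarrow> I \<subseteq> ground M"
  by (simp add: matroid_def)

lemma indep_finite: "matroid M \<Longrightarrow> I \<in> indep M \<Longrightarrow> finite I"
  by (meson indep_subset_ground matroid_finite finite_subset)

lemma indep_empty: "matroid M \<Longrightarrow> {} \<in> indep M"
  by (simp add: matroid_def)

lemma indep_subset: "matroid M \<Longrightarrow> I \<in> indep M \<Longrightarrow> J \<subseteq> I \<Longrightarrow> J \<in> indep M"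
  unfolding matroid_def by blast

lemma indep_exchange:
  "matroid M \<Longrightarrow> I \<in> indep M \<Longrightarrow> J \<in> indep M \<Longrightarrow> card I < card J \<Longrightarrow>
    \<exists>e\<in>J - I. insert e I \<in> indep M"
  unfolding matroid_def by meson

lemma finite_indep: "matroid M \<Longrightarrow> finite (indep M)"
  by (rule finite_subset[of _ "Pow (ground M)"]) (auto simp: matroid_def)

lemma card_le_rank:
  assumes "matroid M" "I \<in> indep M" "I \<subseteq> X"
  shows "card I \<le> rank M X"
  unfolding rank_def using assms finite_indep[OF assms(1)] by (intro Max_ge) auto

lemma rank_attained:
  assumes "matroid M"
  obtains I where "I \<in> indep M" "I \<subseteq> X" "card I = rank M X"
proof -
  have "rank M X \<in> card ` {I \<in> indep M. I \<subseteq> X}"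
    unfolding rank_def using assms finite_indep[OF assms] indep_empty[OF assms]
    by (intro Max_in) auto
  then show thesis using that by auto
qed

lemma rank_le:
  assumes "matroid M" "\<And>I. I \<in> indep M \<Longrightarrow> I \<subseteq> X \<Longrightarrow> card I \<le> n"
  shows "rank M X \<le> n"
  by (rule rank_attained[OF assms(1), of X]) (use assms(2) in force)

lemma rank_mono:
  assumes "matroid M" "X \<subseteq> Y"
  shows "rank M X \<le> rank M Y"
  using assms by (intro rank_le[OF assms(1)] card_le_rank) auto

lemma rank_le_card:
  assumes "matroid M" "finite X"
  shows "rank M X \<le> card X"
  using assms by (intro rank_le[OF assms(1)] card_mono)

lemma rank_le_ground:
  assumes "matroid M"
  shows "rank M X \<le> rank M (ground M)"
  using assms by (intro rank_le[OF assms] card_le_rank indep_subset_ground)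

lemma rank_indep:
  assumes "matroid M" "I \<in> indep M"
  shows "rank M I = card I"
  using assms card_le_rank[of M I I] rank_le_card[of M I] indep_finite[of M I] by simp

text \<open>Exchange against a maximum independent subset of \<open>X\<close> adds one element of
  \<open>X\<close> at a time; the induction is on the missing rank.\<close>

lemma indep_extend:
  assumes M: "matroid M" and "I \<in> indep M" "I \<subseteq> X"
  obtains K where "K \<in> indep M" "I \<subseteq> K" "K \<subseteq> X" "card K = rank M X"
proof -
  have "\<exists>K\<in>indep M. I \<subseteq> K \<and> K \<subseteq> X \<and> card K = rank M X"
    using assms(2,3)
  proof (induction "rank M X - card I" arbitrary: I rule: less_induct)
    case less
    show ?case
    proof (cases "card I = rank M X")
      case False
      then have lt: "card I < rank M X" using card_le_rank[OF M less.prems] by simp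
      obtain J where J: "J \<in> indep M" "J \<subseteq> X" "card J = rank M X"
        using rank_attained[OF M] by metis
      then obtain e where e: "e \<in> J - I" "insert e I \<in> indep M"
        using indep_exchange[OF M less.prems(1) J(1)] lt by auto
      have "card (insert e I) = Suc (card I)"
        using e indep_finite[OF M less.prems(1)] by simp
      then have "rank M X - card (insert e I) < rank M X - card I" using lt by simp
      from less.hyps[OF this e(2)] show ?thesis using e J less.prems by auto
    qed (use less in auto)
  qed
  then show thesis using that by blast
qed

text \<open>Extend a maximum independent subset \<open>I\<close> of the intersection to one,
  \<open>K\<close>, of the union. The traces of \<open>K\<close> on \<open>X\<close> and
  \<open>Y\<close> are independent, and their common part contains \<open>I\<close>.\<close>

lemma rank_submodular:
  assumes M: "matroid M"
  shows "rank M (X \<union> Y) + rank M (X \<inter> Y) \<le> rank M X + rank M Y"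
proof -
  obtain I where I: "I \<in> indep M" "I \<subseteq> X \<inter> Y" "card I = rank M (X \<inter> Y)"
    using rank_attained[OF M] by metis
  then obtain K where K: "K \<in> indep M" "I \<subseteq> K" "K \<subseteq> X \<union> Y" "card K = rank M (X \<union> Y)"
    using indep_extend[OF M I(1), of "X \<union> Y"] by blast
  have fin: "finite K" using indep_finite[OF M K(1)] .
  have "card K + card (K \<inter> X \<inter> Y) = card (K \<inter> X) + card (K \<inter> Y)"
  proof -
    have "K = (K \<inter> X) \<union> (K \<inter> Y)" "K \<inter> X \<inter> Y = (K \<inter> X) \<inter> (K \<inter> Y)" using K by auto
    then show ?thesis using fin card_Un_Int[of "K \<inter> X" "K \<inter> Y"] by simp
  qed
  moreover have "card I \<le> card (K \<inter> X \<inter> Y)" using I K fin by (intro card_mono) auto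
  moreover have "card (K \<inter> X) \<le> rank M X" "card (K \<inter> Y) \<le> rank M Y"
    using K M by (auto intro!: card_le_rank intro: indep_subset)
  ultimately show ?thesis using I K by linarith
qed

lemma rank_Un_le:
  assumes "matroid M" "finite Y"
  shows "rank M (X \<union> Y) \<le> rank M X + card Y"
  using rank_submodular[OF assms(1), of X Y] rank_le_card[OF assms] by linarith

lemma rank_insert_le: "matroid M \<Longrightarrow> rank M (insert e X) \<le> Suc (rank M X)"
  using rank_Un_le[of M "{e}" X] by simp

text \<open>Submodularity for \<open>insert e X\<close> and \<open>Y\<close>, whose intersection
  contains \<open>X\<close>.\<close>

lemma rank_insert_eq_mono:
  assumes M: "matroid M" and "X \<subseteq> Y" "rank M (insert e X) = rank M X"
  shows "rank M (insert e Y) = rank M Y"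
proof -
  have "rank M X \<le> rank M (insert e X \<inter> Y)" using assms by (intro rank_mono) auto
  moreover have "insert e X \<union> Y = insert e Y" using assms by auto
  ultimately show ?thesis
    using rank_submodular[OF M, of "insert e X" Y] assms(3) rank_mono[OF M subset_insertI[of Y e]]
    by simp
qed

lemma rank_Un_absorb:
  assumes M: "matroid M" and "finite Y" "\<And>e. e \<in> Y \<Longrightarrow> rank M (insert e X) = rank M X"
  shows "rank M (X \<union> Y) = rank M X"
  using assms(2,3)
proof (induction Y)
  case (insert e Y)
  have "rank M (insert e (X \<union> Y)) = rank M (X \<union> Y)"
    by (rule rank_insert_eq_mono[OF M, of X]) (use insert.prems in auto)
  then show ?case using insert by simp
qed simp

section \<open>Closure and flats\<close>

lemma closure_subset_ground: "closure M X \<subseteq> ground M"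
  by (auto simp: closure_def)

lemma subset_closure: "X \<subseteq> ground M \<Longrightarrow> X \<subseteq> closure M X"
  by (auto simp: closure_def insert_absorb)

lemma rank_closure:
  assumes "matroid M" "X \<subseteq> ground M"
  shows "rank M (closure M X) = rank M X"
proof -
  have "rank M (X \<union> closure M X) = rank M X"
    using matroid_finite[OF assms(1)]
    by (intro rank_Un_absorb assms) (auto simp: closure_def)
  then show ?thesis using subset_closure[OF assms(2)] by (simp add: Un_absorb1)
qed

lemma closure_mono: "matroid M \<Longrightarrow> X \<subseteq> Y \<Longrightarrow> closure M X \<subseteq> closure M Y"
  using rank_insert_eq_mono[of M X Y] by (auto simp: closure_def)

text \<open>This is how flats are identified below: a rank count replaces any comparison of
  elements.\<close>

lemma closure_eq_of_rank_eq:
  assumes M: "matroid M" and "X \<subseteq> Y" "Y \<subseteq> ground M" "rank M X = rank M Y"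
  shows "closure M X = closure M Y"
proof
  show "closure M X \<subseteq> closure M Y" by (rule closure_mono[OF assms(1,2)])
  show "closure M Y \<subseteq> closure M X"
  proof
    fix e assume e: "e \<in> closure M Y"
    have "rank M (insert e X) \<le> rank M (insert e Y)" using assms by (intro rank_mono) auto
    also have "\<dots> = rank M X" using e assms by (simp add: closure_def)
    finally show "e \<in> closure M X"
      using e rank_mono[OF M subset_insertI[of X e]] by (auto simp: closure_def)
  qed
qed

lemma closure_in_flats:
  assumes "matroid M" "X \<subseteq> ground M"
  shows "closure M X \<in> flats M"
proof -
  have "closure M X = closure M (closure M X)"
    by (rule closure_eq_of_rank_eq[OF assms(1) subset_closure[OF assms(2)]
          closure_subset_ground rank_closure[OF assms, symmetric]])
  then show ?thesis using closure_subset_ground[of M X] unfolding flats_def by blast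
qed

lemma flat_subset_ground: "F \<in> flats M \<Longrightarrow> F \<subseteq> ground M"
  by (simp add: flats_def)

lemma closure_flat: "F \<in> flats M \<Longrightarrow> closure M F = F"
  by (simp add: flats_def)

lemma closure_subset_flat: "matroid M \<Longrightarrow> F \<in> flats M \<Longrightarrow> X \<subseteq> F \<Longrightarrow> closure M X \<subseteq> F"
  using closure_mono[of M X F] closure_flat[of F M] by simp

lemma closure_eq_flat:
  "matroid M \<Longrightarrow> F \<in> flats M \<Longrightarrow> X \<subseteq> F \<Longrightarrow> rank M X = rank M F \<Longrightarrow> closure M X = F"
  using closure_eq_of_rank_eq[of M X F] closure_flat[of F M] flat_subset_ground[of F M] by simp

lemma flat_rank_strict:
  assumes "matroid M" "F \<in> flats M" "G \<in> flats M" "F \<subset> G"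
  shows "rank M F < rank M G"
proof (rule le_neq_implies_less)
  show "rank M F \<le> rank M G" using assms by (intro rank_mono) auto
  show "rank M F \<noteq> rank M G"
    using assms closure_eq_flat[of M G F] closure_flat[of F M] by auto
qed

lemma rank_insert_flat:
  assumes "matroid M" "F \<in> flats M" "e \<in> ground M - F"
  shows "rank M (insert e F) = Suc (rank M F)"
proof -
  have "rank M (insert e F) \<noteq> rank M F" using assms by (auto simp: flats_def closure_def)
  then show ?thesis
    using rank_insert_le[OF assms(1), of e F] rank_mono[OF assms(1) subset_insertI[of F e]] by simp
qed

text \<open>Adding an element \<open>e\<close> and closing gives one cover. Corank at least two
  keeps it proper, so an element \<open>f\<close> outside it yields a second cover, told apart by
  \<open>f\<close>.\<close>

lemma exists_distinct_covers:
  assumes M: "matroid M" and F: "F \<in> flats M" and r: "rank M F + 2 \<le> rank M (ground M)"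
  obtains G H where "G \<in> flats M" "H \<in> flats M" "F \<subseteq> G" "F \<subseteq> H" "G \<noteq> H"
    "rank M G = Suc (rank M F)" "rank M H = Suc (rank M F)"
proof -
  have cover: "closure M (insert e F) \<in> flats M \<and> insert e F \<subseteq> closure M (insert e F) \<and>
      rank M (closure M (insert e F)) = Suc (rank M F)" if "e \<in> ground M - F" for e
  proof -
    have "insert e F \<subseteq> ground M" using that F flat_subset_ground by auto
    then show ?thesis
      using closure_in_flats[OF M] subset_closure rank_closure[OF M] rank_insert_flat[OF M F that]
      by metis
  qed
  have "F \<noteq> ground M" using r by (intro notI) simp
  then obtain e where e: "e \<in> ground M - F" using flat_subset_ground[OF F] by blast
  let ?G = "closure M (insert e F)"
  have "rank M ?G \<noteq> rank M (ground M)" using cover[OF e] r by simp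
  then have "?G \<noteq> ground M" by metis
  then obtain f where f: "f \<in> ground M - ?G" using closure_subset_ground[of M "insert e F"] by auto
  then have f': "f \<in> ground M - F" using cover[OF e] by auto
  show thesis
    by (rule that[of ?G "closure M (insert f F)"]) (use cover[OF e] cover[OF f'] f in auto)
qed

text \<open>Drop one element from a maximum independent subset of \<open>F\<close> and
  close.\<close>

lemma exists_flat_below:
  assumes M: "matroid M" and F: "F \<in> flats M" and r: "rank M F = Suc n"
  obtains G where "G \<in> flats M" "G \<subset> F" "rank M G = n"
proof -
  obtain I where I: "I \<in> indep M" "I \<subseteq> F" "card I = Suc n"
    using rank_attained[OF M] r by metis
  then obtain e where e: "e \<in> I" by fastforce
  have J: "I - {e} \<in> indep M" "I - {e} \<subseteq> ground M"
    using indep_subset[OF M I(1)] indep_subset_ground[OF M I(1)] by auto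
  have n: "rank M (closure M (I - {e})) = n"
    using rank_closure[OF M J(2)] rank_indep[OF M J(1)] e I by simp
  show thesis
  proof (rule that[of "closure M (I - {e})"])
    show "closure M (I - {e}) \<subset> F"
      using closure_subset_flat[OF M F, of "I - {e}"] I n r by auto
  qed (use closure_in_flats[OF M J(2)] n in auto)
qed

section \<open>Duals and minors\<close>

lemma bases_iff:
  assumes M: "matroid M"
  shows "B \<in> bases M \<longleftrightarrow> B \<in> indep M \<and> card B = rank M (ground M)"
proof (intro iffI conjI)
  assume B: "B \<in> bases M"
  then show "B \<in> indep M" by (simp add: bases_def)
  then obtain K where "K \<in> indep M" "B \<subseteq> K" "card K = rank M (ground M)"
    using indep_extend[OF M _ indep_subset_ground[OF M]] by metis
  then show "card B = rank M (ground M)" using B by (auto simp: bases_def)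
next
  assume B: "B \<in> indep M \<and> card B = rank M (ground M)"
  have "I = B" if "I \<in> indep M" "B \<subseteq> I" for I
    using that B card_le_rank[OF M that(1) indep_subset_ground[OF M that(1)]]
      card_seteq[OF indep_finite[OF M that(1)] that(2)] by simp
  then show "B \<in> bases M" using B by (auto simp: bases_def)
qed

lemma ground_dual [simp]: "ground (dual M) = ground M"
  by (simp add: dual_def)

lemma indep_dual_iff:
  assumes "matroid M"
  shows "I \<in> indep (dual M) \<longleftrightarrow>
    I \<subseteq> ground M \<and> (\<exists>B\<in>indep M. card B = rank M (ground M) \<and> B \<inter> I = {})"
  by (auto simp: dual_def bases_iff[OF assms])

text \<open>Exchange holds by counting. If nothing in \<open>J - I\<close> can be added to
  \<open>I\<close>, take a basis \<open>B\<close> avoiding \<open>J\<close> and extend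
  \<open>B - I\<close> to a basis \<open>K\<close> avoiding \<open>I\<close>. Then \<open>K\<close>
  contains the disjoint sets \<open>J - I\<close> and \<open>B - I\<close>. As
  \<open>B \<inter> I\<close> lies in \<open>I - J\<close>, which is smaller than
  \<open>J - I\<close>, this makes \<open>K\<close> larger than \<open>B\<close>.\<close>

lemma matroid_dual:
  assumes M: "matroid M"
  shows "matroid (dual M)"
  unfolding matroid_def
proof (intro conjI ballI allI impI)
  show "finite (ground (dual M))" using matroid_finite[OF M] by simp
  show "I \<subseteq> ground (dual M)" if "I \<in> indep (dual M)" for I
    using that indep_dual_iff[OF M] by simp
  show "{} \<in> indep (dual M)"
    by (rule rank_attained[OF M, of "ground M"]) (auto simp: indep_dual_iff[OF M])
  show "J \<in> indep (dual M)" if "I \<in> indep (dual M)" "J \<subseteq> I" for I J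
    using that unfolding indep_dual_iff[OF M] by blast
  show "\<exists>e\<in>J - I. insert e I \<in> indep (dual M)"
    if I: "I \<in> indep (dual M)" and J: "J \<in> indep (dual M)" and less: "card I < card J" for I J
  proof (rule ccontr)
    assume no: "\<not> ?thesis"
    have IE: "I \<subseteq> ground M" "J \<subseteq> ground M" using I J by (auto simp: indep_dual_iff[OF M])
    obtain B where B: "B \<in> indep M" "card B = rank M (ground M)" "B \<inter> J = {}"
      using J unfolding indep_dual_iff[OF M] by blast
    obtain B0 where B0: "B0 \<in> indep M" "card B0 = rank M (ground M)" "B0 \<inter> I = {}"
      using I unfolding indep_dual_iff[OF M] by blast
    have "card B0 \<le> rank M (ground M - I)"
      using B0 indep_subset_ground[OF M] by (intro card_le_rank[OF M]) auto
    then have rI: "rank M (ground M - I) = rank M (ground M)"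
      using B0 rank_le_ground[OF M, of "ground M - I"] by simp
    obtain K where K: "K \<in> indep M" "B - I \<subseteq> K" "K \<subseteq> ground M - I"
      "card K = rank M (ground M)"
      using indep_extend[OF M, of "B - I" "ground M - I"] rI
        indep_subset[OF M B(1), of "B - I"] indep_subset_ground[OF M B(1)] by auto
    have fin: "finite B" "finite K" "finite I" "finite J"
      using indep_finite[OF M] B K IE matroid_finite[OF M] finite_subset by auto
    \<comment> \<open>Otherwise \<open>K\<close> would be a basis avoiding
      \<open>insert e I\<close>.\<close>
    have JK: "J - I \<subseteq> K"
    proof
      fix e assume e: "e \<in> J - I"
      show "e \<in> K"
      proof (rule ccontr)
        assume "e \<notin> K"
        then have "insert e I \<in> indep (dual M)"
          unfolding indep_dual_iff[OF M] using e IE K by blast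
        then show False using no e by blast
      qed
    qed
    have "card B = card (B \<inter> I) + card (B - I)" using fin card_Int_Diff by metis
    moreover have "card (B \<inter> I) \<le> card (I - J)" using B fin by (intro card_mono) auto
    moreover have "card (I - J) < card (J - I)"
      using less fin card_Int_Diff[of I J] card_Int_Diff[of J I] by (simp add: Int_commute)
    moreover have "card (J - I) + card (B - I) \<le> card K"
    proof -
      have "(J - I) \<inter> (B - I) = {}" using B by auto
      then have "card (J - I) + card (B - I) = card ((J - I) \<union> (B - I))"
        using fin by (simp add: card_Un_disjoint)
      also have "\<dots> \<le> card K" using JK K by (intro card_mono fin) auto
      finally show ?thesis .
    qed
    ultimately show False using B K by simp
  qed
qed

text \<open>The usual corank formula, with the subtraction moved across. One direction takes a basis
  \<open>B\<close> missing a maximum coindependent subset of \<open>X\<close>; the other extends a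
  maximum independent subset of the complement to a basis \<open>B\<close>, so that
  \<open>X - B\<close> is coindependent.\<close>

lemma rank_dual:
  assumes M: "matroid M" and X: "X \<subseteq> ground M"
  shows "rank (dual M) X + rank M (ground M) = card X + rank M (ground M - X)"
proof (rule antisym)
  have finX: "finite X" using X matroid_finite[OF M] finite_subset by blast
  obtain I where I: "I \<in> indep (dual M)" "I \<subseteq> X" "card I = rank (dual M) X"
    using rank_attained[OF matroid_dual[OF M]] by metis
  then obtain B where B: "B \<in> indep M" "card B = rank M (ground M)" "B \<inter> I = {}"
    using indep_dual_iff[OF M] by blast
  have finB: "finite B" using indep_finite[OF M B(1)] .
  have "card I \<le> card (X - B)" using I B finX by (intro card_mono) auto
  moreover have "card X = card (X \<inter> B) + card (X - B)" using finX card_Int_Diff by metis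
  moreover have "card B = card (B \<inter> X) + card (B - X)" using finB card_Int_Diff by metis
  moreover have "card (B - X) \<le> rank M (ground M - X)"
    using indep_subset_ground[OF M B(1)] indep_subset[OF M B(1)]
    by (intro card_le_rank[OF M]) auto
  ultimately show "rank (dual M) X + rank M (ground M) \<le> card X + rank M (ground M - X)"
    using I B by (simp add: Int_commute)
next
  have finX: "finite X" using X matroid_finite[OF M] finite_subset by blast
  obtain A where A: "A \<in> indep M" "A \<subseteq> ground M - X" "card A = rank M (ground M - X)"
    using rank_attained[OF M] by metis
  then obtain B where B: "B \<in> indep M" "A \<subseteq> B" "card B = rank M (ground M)"
    using indep_extend[OF M A(1), of "ground M"] by blast
  have finB: "finite B" using indep_finite[OF M B(1)] .
  have "X - B \<in> indep (dual M)" unfolding indep_dual_iff[OF M] using X B by blast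
  then have "card (X - B) \<le> rank (dual M) X"
    by (intro card_le_rank[OF matroid_dual[OF M]]) auto
  moreover have "card X = card (X \<inter> B) + card (X - B)" using finX card_Int_Diff by metis
  moreover have "card B = card (B \<inter> X) + card (B - X)" using finB card_Int_Diff by metis
  moreover have "card A \<le> card (B - X)" using A B finB by (intro card_mono) auto
  ultimately show "card X + rank M (ground M - X) \<le> rank (dual M) X + rank M (ground M)"
    using A B by (simp add: Int_commute)
qed

section \<open>Deletion and contraction\<close>

lemma ground_delete [simp]: "ground (delete M D) = ground M - D"
  by (simp add: delete_def)

lemma matroid_delete:
  assumes M: "matroid M"
  shows "matroid (delete M D)"
proof -
  have "\<exists>e\<in>J - I. insert e I \<in> indep (delete M D)"
    if IJ: "I \<in> indep (delete M D)" "J \<in> indep (delete M D)" "card I < card J" for I J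
  proof -
    obtain e where "e \<in> J - I" "insert e I \<in> indep M"
      using indep_exchange[OF M, of I J] IJ by (auto simp: delete_def)
    then show ?thesis using IJ by (intro bexI[of _ e]) (auto simp: delete_def)
  qed
  then show ?thesis
    using indep_empty[OF M] indep_subset[OF M] matroid_finite[OF M]
    by (auto simp: matroid_def[of "delete M D"]) (auto simp: delete_def)
qed

lemma rank_delete:
  assumes "X \<subseteq> ground M - D"
  shows "rank (delete M D) X = rank M X"
proof -
  have "{I \<in> indep (delete M D). I \<subseteq> X} = {I \<in> indep M. I \<subseteq> X}"
    using assms by (auto simp: delete_def)
  then show ?thesis by (simp add: rank_def)
qed

lemma ground_contract [simp]: "ground (contract M C) = ground M - C"
  by (simp add: contract_def)

lemma matroid_contract: "matroid M \<Longrightarrow> matroid (contract M C)"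
  by (simp add: contract_def matroid_delete matroid_dual)

text \<open>Contraction is deletion conjugated by duality, so \<open>rank_dual\<close> is used once
  for the outer dual and twice for the inner one; the rest is arithmetic.\<close>

lemma rank_contract:
  assumes M: "matroid M" and C: "C \<subseteq> ground M" and X: "X \<subseteq> ground M - C"
  shows "rank (contract M C) X + rank M C = rank M (X \<union> C)"
proof -
  let ?E = "ground M"
  have "rank (contract M C) X + rank (dual M) (?E - C) = card X + rank (dual M) (?E - C - X)"
    using rank_dual[OF matroid_delete[OF matroid_dual[OF M]], of X C] X
    by (simp add: contract_def rank_delete)
  moreover have "rank (dual M) (?E - C) + rank M ?E = card (?E - C) + rank M C"
    using rank_dual[OF M, of "?E - C"] C by (simp add: double_diff)
  moreover have "rank (dual M) (?E - C - X) + rank M ?E = card (?E - C - X) + rank M (X \<union> C)"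
  proof -
    have "?E - (?E - C - X) = X \<union> C" using C X by auto
    then show ?thesis using rank_dual[OF M, of "?E - C - X"] by auto
  qed
  moreover have "card (?E - C) = card X + card (?E - C - X)"
    using X matroid_finite[OF M]
    by (metis card_Diff_subset card_mono finite_Diff finite_subset le_add_diff_inverse)
  ultimately show ?thesis by linarith
qed

section \<open>Simple matroids\<close>

lemma simple_indep_singleton:
  assumes S: "simple_matroid M" and "e \<in> ground M"
  shows "{e} \<in> indep M"
proof (rule ccontr)
  have M: "matroid M" using S by (simp add: simple_matroid_def)
  assume "{e} \<notin> indep M"
  then have "{e} \<in> circuits M"
    using assms indep_empty[OF M] by (auto simp: circuits_def psubset_eq subset_singleton_iff)
  then show False using S by (simp add: simple_matroid_def)
qed

lemma simple_rank_singleton: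
  assumes "simple_matroid M" "e \<in> ground M"
  shows "rank M {e} = 1"
  using assms rank_indep[OF _ simple_indep_singleton[OF assms]] by (simp add: simple_matroid_def)

lemma simple_rank_doubleton:
  assumes S: "simple_matroid M" and "e \<in> ground M" "f \<in> ground M" "e \<noteq> f"
  shows "rank M {e, f} = 2"
proof -
  have M: "matroid M" using S by (simp add: simple_matroid_def)
  have "{e, f} \<in> indep M"
  proof (rule ccontr)
    assume no: "{e, f} \<notin> indep M"
    have "J \<in> indep M" if "J \<subset> {e, f}" for J
    proof -
      have "J = {} \<or> J = {e} \<or> J = {f}" using that by blast
      then show ?thesis using indep_empty[OF M] simple_indep_singleton[OF S] assms by auto
    qed
    then have "{e, f} \<in> circuits M" using no assms by (auto simp: circuits_def)
    then show False using S assms by (simp add: simple_matroid_def)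
  qed
  then show ?thesis using rank_indep[OF M] assms by fastforce
qed

text \<open>Two distinct elements already have rank 2, so no flat of rank 1 contains both and the
  closure of a singleton does not grow.\<close>

lemma points_simple:
  assumes S: "simple_matroid M"
  shows "points M = (\<lambda>e. {e}) ` ground M"
proof (intro equalityI subsetI)
  have M: "matroid M" using S by (simp add: simple_matroid_def)
  fix F assume F: "F \<in> points M"
  then have FE: "F \<subseteq> ground M" and r: "rank M F = 1" by (auto simp: points_def flats_def)
  have "F \<noteq> {}" using rank_le_card[OF M, of "{}"] r by auto
  then obtain e where e: "e \<in> F" by auto
  have "f = e" if "f \<in> F" for f
    using simple_rank_doubleton[OF S, of e f] rank_mono[OF M, of "{e, f}" F] that e FE r
    by fastforce
  then show "F \<in> (\<lambda>e. {e}) ` ground M" using e FE by auto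
next
  fix F assume "F \<in> (\<lambda>e. {e}) ` ground M"
  then obtain e where e: "e \<in> ground M" "F = {e}" by auto
  have "closure M {e} = {e}"
  proof (intro equalityI subsetI)
    fix f assume f: "f \<in> closure M {e}"
    then have "rank M {e, f} = 1"
      using simple_rank_singleton[OF S e(1)] by (simp add: closure_def insert_commute)
    then show "f \<in> {e}"
      using simple_rank_doubleton[OF S e(1), of f] f by (auto simp: closure_def)
  qed (use e in \<open>simp add: closure_def\<close>)
  then show "F \<in> points M"
    using e simple_rank_singleton[OF S e(1)] by (auto simp: points_def flats_def)
qed

lemma simple_delete:
  assumes "simple_matroid M"
  shows "simple_matroid (delete M D)"
proof -
  have "C \<in> circuits M" if "C \<in> circuits (delete M D)" for C
    using that by (auto simp: circuits_def delete_def)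
  then show ?thesis using assms matroid_delete unfolding simple_matroid_def by blast
qed

section \<open>Adjoints\<close>

text \<open>Each step down a chain of flats ending at rank 0 strictly enlarges the image, whose rank
  can never exceed that of \<open>M'\<close>. Only this inequality comes from the map itself; the
  matching lower bound comes from the points.\<close>

lemma adjoint_map_rank_le:
  assumes M: "matroid M" and M': "matroid M'"
    and r: "rank M' (ground M') = rank M (ground M)"
    and \<phi>: "adjoint_map M M' \<phi>" and F: "F \<in> flats M"
  shows "rank M' (\<phi> F) + rank M F \<le> rank M (ground M)"
  using F
proof (induction "rank M F" arbitrary: F)
  case 0
  then show ?case using rank_le_ground[OF M', of "\<phi> F"] r by simp
next
  case (Suc n)
  obtain G where G: "G \<in> flats M" "G \<subset> F" "rank M G = n"
    using exists_flat_below[OF M Suc.prems Suc.hyps(2)[symmetric]] .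
  have "\<phi> F \<noteq> \<phi> G"
    using \<phi> G Suc.prems unfolding adjoint_map_def by (metis inj_onD psubset_eq)
  moreover have "\<phi> F \<subseteq> \<phi> G" "\<phi> F \<in> flats M'" "\<phi> G \<in> flats M'"
    using \<phi> G Suc.prems by (auto simp: adjoint_map_def)
  ultimately have "rank M' (\<phi> F) < rank M' (\<phi> G)"
    by (intro flat_rank_strict[OF M']) auto
  then show ?case using Suc.hyps(1)[of G] G Suc.hyps(2) by simp
qed

text \<open>The flat \<open>\<phi> (\<iota> F)\<close> may contain points of \<open>M'\<close> that do not come from hyperplanes above
  \<open>F\<close>, so the adjoint of \<open>N\<close> has to be cut down to the points \<open>\<phi> (\<iota> H)\<close>. That these still
  span \<open>\<phi> (\<iota> F)\<close> is shown by induction on the corank: two distinct covers of \<open>F\<close> have distinct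
  images, so both images cannot equal the span of the points above \<open>F\<close>.\<close>

lemma has_adjoint_of_flat_embedding:
  fixes M :: "'a matroid_data" and N :: "'b matroid_data"
  assumes N: "matroid N" and adj: "has_adjoint M"
    and \<iota>_flat: "\<And>F. F \<in> flats N \<Longrightarrow> \<iota> F \<in> flats M"
    and \<iota>_mono: "\<And>F G. F \<in> flats N \<Longrightarrow> G \<in> flats N \<Longrightarrow> F \<subseteq> G \<Longrightarrow> \<iota> F \<subseteq> \<iota> G"
    and \<iota>_inj: "inj_on \<iota> (flats N)"
    and \<iota>_rank: "\<And>F. F \<in> flats N \<Longrightarrow>
      rank M (\<iota> F) + rank N (ground N) = rank M (ground M) + rank N F"
  shows "has_adjoint N"
proof -
  obtain M' :: "nat matroid_data" and \<phi> where M: "matroid M" and S: "simple_matroid M'"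
    and r: "rank M' (ground M') = rank M (ground M)" and \<phi>: "adjoint_map M M' \<phi>"
    using adj by (auto simp: has_adjoint_def adjoint_def)
  have M': "matroid M'" using S by (simp add: simple_matroid_def)
  define \<theta> where "\<theta> F = \<phi> (\<iota> F)" for F
  have \<theta>_flat: "\<theta> F \<in> flats M'" if "F \<in> flats N" for F
    using \<phi> \<iota>_flat[OF that] by (auto simp: \<theta>_def adjoint_map_def)
  have \<theta>_antimono: "\<theta> G \<subseteq> \<theta> F" if "F \<in> flats N" "G \<in> flats N" "F \<subseteq> G" for F G
    using \<phi> \<iota>_flat \<iota>_mono[OF that] that by (simp add: \<theta>_def adjoint_map_def)
  have \<theta>_inj: "F = G" if "F \<in> flats N" "G \<in> flats N" "\<theta> F = \<theta> G" for F G
    using that \<phi> \<iota>_flat \<iota>_inj unfolding \<theta>_def adjoint_map_def by (meson inj_onD)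
  have \<theta>_rank_le: "rank M' (\<theta> F) + rank N F \<le> rank N (ground N)" if "F \<in> flats N" for F
    using adjoint_map_rank_le[OF M M' r \<phi> \<iota>_flat[OF that]] \<iota>_rank[OF that]
    by (simp add: \<theta>_def)
  have \<theta>_point: "\<theta> H \<in> points M'" if "H \<in> hyperplanes N" for H
  proof -
    have "\<iota> H \<in> hyperplanes M"
      using that \<iota>_flat[of H] \<iota>_rank[of H] by (auto simp: hyperplanes_def)
    then show ?thesis using \<phi> by (auto simp: \<theta>_def adjoint_map_def dest: bij_betwE)
  qed
  \<comment> \<open>These are the points of \<open>M'\<close> contributed by the hyperplanes of
    \<open>N\<close> above \<open>F\<close>.\<close>
  define P where "P F = \<Union> (\<theta> ` {H \<in> hyperplanes N. F \<subseteq> H})" for F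
  have P_antimono: "P G \<subseteq> P F" if "F \<subseteq> G" for F G using that by (auto simp: P_def)
  have P_sub: "P F \<subseteq> \<theta> F" if "F \<in> flats N" for F
    using \<theta>_antimono that by (auto simp: P_def hyperplanes_def)
  have P_ground: "P F \<subseteq> ground M'" for F
    using flat_subset_ground[OF \<theta>_flat] by (fastforce simp: P_def hyperplanes_def)
  have P_rank_ge: "rank N (ground N) \<le> rank M' (P F) + rank N F" if "F \<in> flats N" for F
    using that
  proof (induction "rank N (ground N) - rank N F" arbitrary: F rule: less_induct)
    case less
    consider "rank N (ground N) \<le> rank N F" | "rank N F + 1 = rank N (ground N)"
      | "rank N F + 2 \<le> rank N (ground N)" by linarith
    then show ?case
    proof cases
      case 2
      then have H: "F \<in> hyperplanes N" using less.prems by (simp add: hyperplanes_def)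
      then have "rank M' (\<theta> F) = 1" using \<theta>_point by (simp add: points_def)
      moreover have "\<theta> F \<subseteq> P F" using H by (auto simp: P_def)
      ultimately show ?thesis using rank_mono[OF M', of "\<theta> F" "P F"] 2 by simp
    next
      case 3
      obtain G H where GH: "G \<in> flats N" "H \<in> flats N" "F \<subseteq> G" "F \<subseteq> H" "G \<noteq> H"
        "rank N G = Suc (rank N F)" "rank N H = Suc (rank N F)"
        using exists_distinct_covers[OF N less.prems 3] .
      show ?thesis
      proof (rule ccontr)
        assume small: "\<not> ?thesis"
        \<comment> \<open>With c the corank of \<open>F\<close>, the induction hypothesis gives
          \<open>P K\<close> rank at least c - 1, while \<open>\<theta> K\<close> (by
          \<open>\<theta>_rank_le\<close>) and \<open>P F\<close> (by \<open>small\<close>) have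
          rank at most c - 1. Both contain \<open>P K\<close>, so all three have the same
          closure.\<close>
        have "\<theta> K = closure M' (P F)"
          if K: "K \<in> flats N" "F \<subseteq> K" "rank N K = Suc (rank N F)" for K
        proof -
          have ge: "rank N (ground N) \<le> rank M' (P K) + rank N K"
            using less.hyps[of K] K 3 by simp
          have "closure M' (P K) = \<theta> K"
            using ge \<theta>_rank_le[OF K(1)] rank_mono[OF M' P_sub[OF K(1)]]
            by (intro closure_eq_flat[OF M' \<theta>_flat[OF K(1)] P_sub[OF K(1)]]) simp
          moreover have "closure M' (P K) = closure M' (P F)"
            using ge small K rank_mono[OF M' P_antimono[OF K(2)]]
            by (intro closure_eq_of_rank_eq[OF M' P_antimono[OF K(2)] P_ground]) simp
          ultimately show ?thesis by simp
        qed
        then show False using GH \<theta>_inj by metis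
      qed
    qed simp
  qed
  \<comment> \<open>The set of loops is the least flat, so \<open>Q\<close> below collects the
    points of all hyperplanes of \<open>N\<close>.\<close>
  define F0 where "F0 = closure N {}"
  have F0: "F0 \<in> flats N" "rank N F0 = 0"
    using closure_in_flats[OF N] rank_closure[OF N] rank_le_card[OF N, of "{}"]
    by (auto simp: F0_def)
  define Q where "Q = P F0"
  have F0_least: "F0 \<subseteq> F" if "F \<in> flats N" for F
    using closure_subset_flat[OF N that] by (simp add: F0_def)
  have P_Q: "P F \<subseteq> Q" if "F \<in> flats N" for F
    unfolding Q_def by (rule P_antimono[OF F0_least[OF that]])
  have Q_ground: "Q \<subseteq> ground M'" by (simp add: Q_def P_ground)
  have \<theta>_Q: "closure M' (\<theta> F \<inter> Q) = \<theta> F" "rank M' (\<theta> F \<inter> Q) = rank M' (\<theta> F)"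
    if F: "F \<in> flats N" for F
  proof -
    \<comment> \<open>\<open>\<theta> F \<inter> Q\<close> lies between \<open>P F\<close> and
      \<open>\<theta> F\<close>, and both of these have rank equal to the corank of
      \<open>F\<close>.\<close>
    have "rank M' (P F) \<le> rank M' (\<theta> F \<inter> Q)"
      using P_sub[OF F] P_Q[OF F] by (intro rank_mono[OF M']) auto
    then show *: "rank M' (\<theta> F \<inter> Q) = rank M' (\<theta> F)"
      using P_rank_ge[OF F] \<theta>_rank_le[OF F] rank_mono[OF M' Int_lower1[of "\<theta> F" Q]] by simp
    then show "closure M' (\<theta> F \<inter> Q) = \<theta> F"
      by (intro closure_eq_flat[OF M' \<theta>_flat[OF F]]) auto
  qed
  \<comment> \<open>The restriction to \<open>Q\<close>, phrased as a deletion; its elements are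
    still natural numbers, as \<open>has_adjoint\<close> demands.\<close>
  define M'' where "M'' = delete M' (ground M' - Q)"
  define \<psi> where "\<psi> F = \<theta> F \<inter> Q" for F
  have ground'': "ground M'' = Q" using Q_ground by (auto simp: M''_def)
  have rank'': "rank M'' X = rank M' X" if "X \<subseteq> Q" for X
    unfolding M''_def using that Q_ground by (intro rank_delete) auto
  have S'': "simple_matroid M''" unfolding M''_def by (rule simple_delete[OF S])
  have \<theta>_hyp: "\<exists>e\<in>Q. \<theta> H = {e}" if H: "H \<in> hyperplanes N" for H
  proof -
    obtain e where e: "\<theta> H = {e}" using \<theta>_point[OF H] points_simple[OF S] by auto
    have "H \<in> {H \<in> hyperplanes N. F0 \<subseteq> H}"
      using H F0_least by (auto simp: hyperplanes_def)
    then have "e \<in> Q" unfolding Q_def P_def using e by blast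
    then show ?thesis using e by auto
  qed
  have "adjoint_map N M'' \<psi>"
    unfolding adjoint_map_def
  proof (intro conjI ballI impI)
    show "\<psi> ` flats N \<subseteq> flats M''"
    proof (rule image_subsetI)
      fix F assume F: "F \<in> flats N"
      have "closure M'' (\<psi> F) = closure M' (\<psi> F) \<inter> Q"
        using Q_ground by (auto simp: closure_def ground'' rank'' \<psi>_def)
      then show "\<psi> F \<in> flats M''"
        using \<theta>_Q[OF F] by (auto simp: flats_def \<psi>_def ground'')
    qed
    \<comment> \<open>\<open>\<theta> F\<close> is recovered from \<open>\<psi> F\<close> as its
      closure in \<open>M'\<close>.\<close>
    show inj: "inj_on \<psi> (flats N)"
      unfolding \<psi>_def by (rule inj_onI) (metis \<theta>_Q(1) \<theta>_inj)
    show "\<psi> G \<subseteq> \<psi> F" if "F \<in> flats N" "G \<in> flats N" "F \<subseteq> G" for F G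
      using \<theta>_antimono[OF that] by (auto simp: \<psi>_def)
    have "\<psi> H = \<theta> H" if "H \<in> hyperplanes N" for H
      using \<theta>_hyp[OF that] by (auto simp: \<psi>_def)
    then have "\<psi> ` hyperplanes N = \<theta> ` hyperplanes N" by simp
    also have "\<dots> = (\<lambda>e. {e}) ` Q"
    proof (intro equalityI subsetI)
      fix Z assume "Z \<in> (\<lambda>e. {e}) ` Q"
      then obtain e H where "Z = {e}" "e \<in> \<theta> H" "H \<in> hyperplanes N"
        by (auto simp: Q_def P_def)
      then show "Z \<in> \<theta> ` hyperplanes N" using \<theta>_hyp by fastforce
    qed (use \<theta>_hyp in auto)
    also have "\<dots> = points M''" by (simp add: points_simple[OF S''] ground'')
    finally show "bij_betw \<psi> (hyperplanes N) (points M'')"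
      using inj by (auto simp: bij_betw_def hyperplanes_def intro: inj_on_subset)
  qed
  \<comment> \<open>The two rank bounds at \<open>F0\<close>, whose corank is the full rank of
    \<open>N\<close>.\<close>
  moreover have "rank M'' (ground M'') = rank N (ground N)"
    using P_rank_ge[OF F0(1)] \<theta>_rank_le[OF F0(1)] rank_mono[OF M' P_sub[OF F0(1)]] F0(2)
    by (simp add: ground'' rank'' Q_def)
  ultimately have "adjoint N M''" using N S'' by (auto simp: adjoint_def)
  then show ?thesis unfolding has_adjoint_def by blast
qed

section \<open>Embedding the flats of a minor\<close>

theorem theorem3p4:
  fixes M N :: "'a matroid_data"
  assumes "matroid M"
    and "has_adjoint M"
    and "minor N M"
  shows "has_adjoint N"
proof -
  note M = assms(1)
  obtain C D where C: "C \<subseteq> ground M" and N_def: "N = delete (contract M C) D"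
    using assms(3) by (auto simp: minor_def)
  have N: "matroid N" by (simp add: N_def matroid_delete matroid_contract M)
  define S where "S = ground N"
  have S: "S = ground M - C - D" by (simp add: S_def N_def)
  have rank_N: "rank N X + rank M C = rank M (X \<union> C)" if "X \<subseteq> S" for X
  proof -
    have "rank N X = rank (contract M C) X"
      unfolding N_def using that S by (intro rank_delete) auto
    then show ?thesis using rank_contract[OF M C, of X] that S by auto
  qed
  text \<open>The elements of \<open>B\<close> are coloops of the restriction of \<open>M\<close> to \<open>S \<union> C \<union> B\<close>, so \<open>N\<close> is also
    obtained by contracting \<open>C \<union> B\<close>; as \<open>S \<union> C \<union> B\<close> spans \<open>M\<close>, \<open>F \<mapsto> closure M (F \<union> C \<union> B)\<close>
    preserves coranks.\<close>
  obtain B where B: "B \<subseteq> ground M" "rank M (S \<union> C \<union> B) = rank M (ground M)"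
    "rank M (S \<union> C) + card B = rank M (ground M)"
  proof -
    \<comment> \<open>The witness for \<open>B\<close> is \<open>K - I\<close>, where the basis
      \<open>K\<close> of \<open>M\<close> extends a maximum independent subset \<open>I\<close> of
      \<open>S \<union> C\<close>.\<close>
    obtain I where I: "I \<in> indep M" "I \<subseteq> S \<union> C" "card I = rank M (S \<union> C)"
      using rank_attained[OF M] by metis
    obtain K where K: "K \<in> indep M" "I \<subseteq> K" "card K = rank M (ground M)"
      using indep_extend[OF M I(1) indep_subset_ground[OF M I(1)]] by metis
    have "card K \<le> rank M (S \<union> C \<union> (K - I))" using K I by (intro card_le_rank[OF M]) auto
    then have "rank M (S \<union> C \<union> (K - I)) = rank M (ground M)"
      using K rank_le_ground[OF M] by (simp add: antisym)
    moreover have "card I + card (K - I) = card K"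
      using indep_finite[OF M K(1)] K(2)
      by (simp add: card_Diff_subset card_mono finite_subset)
    ultimately show thesis
      using that[of "K - I"] indep_subset_ground[OF M K(1)] I K by auto
  qed
  have finB: "finite B" using B(1) matroid_finite[OF M] finite_subset by blast
  define X where "X F = F \<union> C \<union> B" for F
  have X_ground: "X F \<subseteq> ground M" if "F \<subseteq> S" for F using that S C B by (auto simp: X_def)
  have rank_X: "rank M (X F) = rank N F + rank M C + card B" if F: "F \<subseteq> S" for F
  proof -
    have "rank M (X F) \<le> rank M (F \<union> C) + card B"
      unfolding X_def by (rule rank_Un_le[OF M finB])
    \<comment> \<open>Submodularity for \<open>S \<union> C\<close> and \<open>X F\<close>: their
      union spans \<open>M\<close>, their intersection contains \<open>F \<union> C\<close>, and
      \<open>card B\<close> is exactly the rank missing from \<open>S \<union> C\<close>.\<close>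
    moreover have "rank M (F \<union> C) + card B \<le> rank M (X F)"
    proof -
      have "S \<union> C \<union> X F = S \<union> C \<union> B" using F by (auto simp: X_def)
      moreover have "rank M (F \<union> C) \<le> rank M ((S \<union> C) \<inter> X F)"
        using F by (intro rank_mono[OF M]) (auto simp: X_def)
      ultimately show ?thesis using rank_submodular[OF M, of "S \<union> C" "X F"] B by simp
    qed
    ultimately show ?thesis using rank_N[OF F] by simp
  qed
  have sub: "F \<subseteq> S" if "F \<in> flats N" for F using flat_subset_ground[OF that] by (simp add: S_def)
  show ?thesis
  proof (rule has_adjoint_of_flat_embedding[OF N assms(2), of "\<lambda>F. closure M (X F)"])
    show "closure M (X F) \<in> flats M" if "F \<in> flats N" for F
      by (rule closure_in_flats[OF M X_ground[OF sub[OF that]]])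
    show "closure M (X F) \<subseteq> closure M (X G)" if "F \<subseteq> G" for F G
      using that by (intro closure_mono[OF M]) (auto simp: X_def)
    show "rank M (closure M (X F)) + rank N (ground N) = rank M (ground M) + rank N F"
      if "F \<in> flats N" for F
      using rank_closure[OF M X_ground] rank_X rank_N[of S] sub[OF that] B by (simp add: S_def)
    show "inj_on (\<lambda>F. closure M (X F)) (flats N)"
    proof (rule inj_onI)
      \<comment> \<open>Equal closures force \<open>F \<union> G\<close> to have the same rank as
        \<open>F\<close> in \<open>N\<close>, and a flat absorbs whatever does not raise its
        rank.\<close>
      have le: "G \<subseteq> F" if F: "F \<in> flats N" and G: "G \<in> flats N"
        and eq: "closure M (X F) = closure M (X G)" for F G
      proof -
        note FS = sub[OF F] and GS = sub[OF G]
        have "X (F \<union> G) \<subseteq> closure M (X F)"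
          using subset_closure[OF X_ground[OF FS]] subset_closure[OF X_ground[OF GS]] eq
          by (auto simp: X_def)
        then have "rank M (X (F \<union> G)) \<le> rank M (X F)"
          using rank_mono[OF M] rank_closure[OF M X_ground[OF FS]] by metis
        then have "rank N F = rank N (F \<union> G)"
          using rank_X[OF FS] rank_X[of "F \<union> G"] FS GS rank_mono[OF N Un_upper1[of F G]] by simp
        then have "closure N F = closure N (F \<union> G)"
          using FS GS by (intro closure_eq_of_rank_eq[OF N]) (auto simp: S_def)
        then show ?thesis
          using closure_flat[OF F] subset_closure[of "F \<union> G" N] FS GS by (auto simp: S_def)
      qed
      fix F G assume "F \<in> flats N" "G \<in> flats N" "closure M (X F) = closure M (X G)"
      then show "F = G" using le[of F G] le[of G F] by auto
    qed
  qed
qed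

end
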